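(* Let $C$ be a cycle of goods and $N=\{1,\dots,n\}$, $n\ge2$, a set of agents, each with a utility function on $C$. Let $$c=\max_{d\in\{n,n+1,\dots\}}\min\left(\frac{n}{d},\ \frac{n}{\lceil n^2/d\rceil+n-2}\right).$$ Then there exists a $c$-sufficient allocation of the goods of $C$ to the agents in $N$.
   Context: A cycle of goods has goods $v_1,\dots,v_m$ with edges $v_iv_{i+1}$ and $v_mv_1$. A utility function assigns a non-negative real to each good, extended additively to sets. A bundle is a set of goods inducing a connected subgraph (empty allowed); an $n$-split is a sequence of $n$ pairwise disjoint bundles (possibly empty) with union all goods. $\mathrm{mms}^{(n)}(C,u)=\max_{P_1,\dots,P_n}\min_i u(P_i)$ over all $n$-splits. An allocation to agents $1,\dots,n$ with utilities $u_1,\dots,u_n$ is an $n$-split $P_1,\dots,P_n$ with $P_i$ given to agent $i$; for $c>0$ it is $c$-sufficient if $u_i(P_i)\ge c\cdot\mathrm{mms}^{(n)}(C,u_i)$ for all $i$. *)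

theory Defs
  imports Complex_Main
begin

text \<open>A cycle of goods with m goods: goods are 0,...,m-1 (standing for v_1,...,v_m),
  good i is adjacent to good (i+1) mod m.\<close>

definition cyc_adj :: "nat \<Rightarrow> nat \<Rightarrow> nat \<Rightarrow> bool" where
  "cyc_adj m i j \<longleftrightarrow> i < m \<and> j < m \<and> (j = Suc i mod m \<or> i = Suc j mod m)"

definition is_bundle :: "nat \<Rightarrow> nat set \<Rightarrow> bool" where
  "is_bundle m S \<longleftrightarrow> S \<subseteq> {..<m} \<and>
     (\<forall>x\<in>S. \<forall>y\<in>S. (x, y) \<in> rtrancl {(a, b). a \<in> S \<and> b \<in> S \<and> cyc_adj m a b})"

definition is_split :: "nat \<Rightarrow> nat \<Rightarrow> (nat \<Rightarrow> nat set) \<Rightarrow> bool" where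
  "is_split m n P \<longleftrightarrow> (\<forall>i\<in>{1..n}. is_bundle m (P i)) \<and>
     (\<forall>i\<in>{1..n}. \<forall>j\<in>{1..n}. i \<noteq> j \<longrightarrow> P i \<inter> P j = {}) \<and>
     (\<Union>i\<in>{1..n}. P i) = {..<m}"

definition util :: "(nat \<Rightarrow> real) \<Rightarrow> nat set \<Rightarrow> real" where
  "util u S = (\<Sum>g\<in>S. u g)"

definition mms :: "nat \<Rightarrow> nat \<Rightarrow> (nat \<Rightarrow> real) \<Rightarrow> real" where
  "mms m n u = Sup {Min ((\<lambda>i. util u (P i)) ` {1..n}) | P. is_split m n P}"

definition c_sufficient :: "nat \<Rightarrow> nat \<Rightarrow> (nat \<Rightarrow> nat \<Rightarrow> real) \<Rightarrow> real \<Rightarrow> (nat \<Rightarrow> nat set) \<Rightarrow> bool" where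
  "c_sufficient m n U c P \<longleftrightarrow> is_split m n P \<and>
     (\<forall>i\<in>{1..n}. util (U i) (P i) \<ge> c * mms m n (U i))"

definition c_const :: "nat \<Rightarrow> real" where
  "c_const n = (SUP d\<in>{n..}. min (real n / real d)
      (real n / (real_of_int \<lceil>real n ^ 2 / real d\<rceil> + real n - 2)))"

end

theory Submission
  imports Defs
begin

text \<open>
  Let the threshold of an agent be c times her maximin share, where c is attained at d, and put
  x = \<lceil>n^2/d\<rceil>. If an arc Q is acceptable to an agent i, then every other agent whose maximin split has no
  cut inside Q keeps n - 1 whole bundles in the path left over, while the agents with such a cut
  only know that their value of the path is large. A greedy procedure on the path serves both
  kinds at once: a greedy piece destroys at most one whole bundle, and it costs an agent of the
  second kind less than one threshold, or at most two if an agent of that kind takes it.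

  If some single good is acceptable, Q consists of this good. Otherwise list the at most n^2
  cuts of all agents around the cycle. On average an arc of x consecutive cut-free pieces
  has value at least n/d maximin shares for agent 1, so one of them is acceptable; take for Q its
  shortest acceptable prefix. At most x - 1 agents have a cut inside Q, and if one of them
  accepts Q, she is chosen as i; otherwise they all value Q below their threshold. In both cases
  n \<ge> c (x + n - 2) leaves enough value on the path.
\<close>

section \<open>Greedy division of a path\<close>

text \<open>Agents in S own sufficiently many whole bundles, agents in T have many small goods. The
  shortest acceptable prefix goes to an agent in T whenever one accepts it: this is why an agent
  in S taking a piece costs each agent in T only one threshold.\<close>

lemma path_allocation:
  fixes u :: "nat \<Rightarrow> nat \<Rightarrow> real" and thr :: "nat \<Rightarrow> real"
    and K :: "nat \<Rightarrow> nat set" and F :: "nat \<Rightarrow> nat \<Rightarrow> nat set"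
  assumes "finite S" "finite T" "S \<inter> T = {}" "S \<union> T \<noteq> {}" "a \<le> b"
    and nonneg: "\<And>j q. j \<in> S \<union> T \<Longrightarrow> 0 \<le> u j q"
    and thr: "\<And>j. j \<in> S \<union> T \<Longrightarrow> 0 \<le> thr j"
    and small: "\<And>j q. j \<in> T \<Longrightarrow> u j q \<le> thr j"
    and T: "\<And>j. j \<in> T \<Longrightarrow> (real (card S) + 2 * real (card T) - 1) * thr j \<le> sum (u j) {a..<b}"
    and finK: "\<And>j. j \<in> S \<Longrightarrow> finite (K j)"
    and conv: "\<And>j k x y z. \<lbrakk>j \<in> S; k \<in> K j; x \<in> F j k; y \<in> F j k; x \<le> z; z \<le> y\<rbrakk> \<Longrightarrow> z \<in> F j k"
    and disj: "\<And>j k l. \<lbrakk>j \<in> S; k \<in> K j; l \<in> K j; k \<noteq> l\<rbrakk> \<Longrightarrow> F j k \<inter> F j l = {}"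
    and val: "\<And>j k. \<lbrakk>j \<in> S; k \<in> K j\<rbrakk> \<Longrightarrow> thr j \<le> sum (u j) (F j k)"
    and S: "\<And>j. j \<in> S \<Longrightarrow> card S + card T \<le> card {k \<in> K j. F j k \<subseteq> {a..<b}}"
  shows "\<exists>I. (\<forall>j\<in>S \<union> T. (\<exists>l h. I j = {l..<h}) \<and> thr j \<le> sum (u j) (I j)) \<and>
    (\<forall>j\<in>S \<union> T. \<forall>k\<in>S \<union> T. j \<noteq> k \<longrightarrow> I j \<inter> I k = {}) \<and> (\<Union>j\<in>S \<union> T. I j) = {a..<b}"
  using assms
proof (induction "card S + card T" arbitrary: S T a rule: less_induct)
  case less
  note fS = less.prems(1) and fT = less.prems(2) and ST = less.prems(3) and ne = less.prems(4)
    and ab = less.prems(5) and nonneg = less.prems(6) and thr = less.prems(7) and small = less.prems(8)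
    and T = less.prems(9) and finK = less.prems(10) and conv = less.prems(11) and disj = less.prems(12)
    and val = less.prems(13) and S = less.prems(14)
  \<comment> \<open>Any remaining agent would accept the whole path: a member of \<open>T\<close>
    because her multiple is at least 1, a member of \<open>S\<close> because a whole bundle
    survives. Hence a shortest acceptable prefix exists, and a last agent can take everything that
    is left.\<close>
  have whole: "thr j \<le> sum (u j) {a..<b}" if j: "j \<in> S \<union> T" for j
  proof (cases "j \<in> T")
    case True
    then have "1 \<le> card T" using fT by (metis One_nat_def Suc_leI card_gt_0_iff empty_iff)
    then have "1 * thr j \<le> (real (card S) + 2 * real (card T) - 1) * thr j"
      using thr[OF j] by (intro mult_right_mono) auto
    then show ?thesis using T[OF True] by simp
  next
    case False
    then have jS: "j \<in> S" using j by auto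
    then have "0 < card S" using fS card_gt_0_iff by blast
    then have "{k \<in> K j. F j k \<subseteq> {a..<b}} \<noteq> {}" using S[OF jS] by (metis add_is_0 card.empty le_zero_eq less_not_refl)
    then obtain k where k: "k \<in> K j" "F j k \<subseteq> {a..<b}" by blast
    have "thr j \<le> sum (u j) (F j k)" using val jS k by blast
    also have "\<dots> \<le> sum (u j) {a..<b}" using k nonneg[OF j] by (intro sum_mono2) auto
    finally show ?thesis .
  qed
  define p where "p = (LEAST p. a \<le> p \<and> (\<exists>j\<in>S \<union> T. thr j \<le> sum (u j) {a..<p}))"
  obtain j0 where j0: "j0 \<in> S \<union> T" using ne by blast
  have ex: "a \<le> b \<and> (\<exists>j\<in>S \<union> T. thr j \<le> sum (u j) {a..<b})"
    using whole[OF j0] j0 ab by blast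
  have p: "a \<le> p" "\<exists>j\<in>S \<union> T. thr j \<le> sum (u j) {a..<p}"
    using LeastI[of "\<lambda>p. a \<le> p \<and> (\<exists>j\<in>S \<union> T. thr j \<le> sum (u j) {a..<p})", OF ex] unfolding p_def by auto
  have pb: "p \<le> b" unfolding p_def using ex by (rule Least_le)
  have before: "sum (u j) {a..<q} < thr j" if "j \<in> S \<union> T" "a \<le> q" "q < p" for j q
    using not_less_Least[of q "\<lambda>p. a \<le> p \<and> (\<exists>j\<in>S \<union> T. thr j \<le> sum (u j) {a..<p})"] that
    unfolding p_def by force
  obtain i where i: "i \<in> S \<union> T" "thr i \<le> sum (u i) {a..<p}"
    and iT: "i \<notin> T \<Longrightarrow> \<forall>j\<in>T. sum (u j) {a..<p} < thr j"
    using p(2) by (metis UnI2 not_le)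
  show ?case
  proof (cases "S \<union> T = {i}")
    case True
    then show ?thesis using whole[OF i(1)] by (intro exI[of _ "\<lambda>_. {a..<b}"]) auto
  next
    case False
    define S' T' where "S' = S - {i}" and "T' = T - {i}"
    have ne': "S' \<union> T' \<noteq> {}" using False i unfolding S'_def T'_def by blast
    have cards: "card S' + card T' + 1 = card S + card T"
      "i \<in> T \<Longrightarrow> card S' = card S \<and> card T' + 1 = card T"
      "i \<notin> T \<Longrightarrow> card S' + 1 = card S \<and> card T' = card T"
    proof -
      have *: "i \<in> T \<Longrightarrow> card S' = card S \<and> card T' + 1 = card T"
        using ST fT card_Suc_Diff1[of T i] card_Diff_singleton_if[of S i] unfolding S'_def T'_def by auto
      have **: "i \<notin> T \<Longrightarrow> card S' + 1 = card S \<and> card T' = card T"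
        using i ST fS card_Suc_Diff1[of S i] unfolding S'_def T'_def by auto
      show "card S' + card T' + 1 = card S + card T" using * ** by (cases "i \<in> T") auto
      show "i \<in> T \<Longrightarrow> card S' = card S \<and> card T' + 1 = card T" by fact
      show "i \<notin> T \<Longrightarrow> card S' + 1 = card S \<and> card T' = card T" by fact
    qed
    \<comment> \<open>If \<open>i\<close> is in \<open>T\<close>, the required multiple of the
      threshold drops by 2; otherwise it drops by 1, and by the choice of \<open>i\<close> the piece
      is worth less than one threshold to \<open>j\<close>.\<close>
    have T': "(real (card S') + 2 * real (card T') - 1) * thr j \<le> sum (u j) {p..<b}" if j: "j \<in> T'" for j
    proof -
      have jT: "j \<in> T" and jST: "j \<in> S \<union> T" using j unfolding T'_def by auto
      have split: "sum (u j) {a..<b} = sum (u j) {a..<p} + sum (u j) {p..<b}"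
        using p(1) pb by (simp add: sum.atLeastLessThan_concat)
      show ?thesis
      proof (cases "i \<in> T")
        case True
        \<comment> \<open>One threshold bounds the piece without its last good \<open>r\<close>, by
          minimality of \<open>p\<close>, and one bounds \<open>r\<close> itself. The piece is empty
          when some threshold is 0.\<close>
        have "sum (u j) {a..<p} \<le> 2 * thr j"
        proof (cases "p = a")
          case True
          then show ?thesis using thr[OF jST] by simp
        next
          case False
          then obtain r where r: "p = Suc r" "a \<le> r" using p(1) by (cases p) auto
          then show ?thesis using before[OF jST, of r] small[OF jT, of r] by simp
        qed
        moreover have "real (card S) = real (card S')" "real (card T) = real (card T') + 1"
          using cards(2)[OF True] by auto
        ultimately show ?thesis using T[OF jT] split by (simp add: algebra_simps)
      next
        case False
        have "sum (u j) {a..<p} < thr j" using iT[OF False] jT by blast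
        moreover have "real (card S) = real (card S') + 1" "real (card T) = real (card T')"
          using cards(3)[OF False] by auto
        ultimately show ?thesis using T[OF jT] split by (simp add: algebra_simps)
      qed
    qed
    have S': "card S' + card T' \<le> card {k \<in> K j. F j k \<subseteq> {p..<b}}" if j: "j \<in> S'" for j
    proof -
      have jS: "j \<in> S" and jST: "j \<in> S \<union> T" using j unfolding S'_def by auto
      let ?A = "{k \<in> K j. F j k \<subseteq> {a..<b}}" and ?B = "{k \<in> K j. F j k \<subseteq> {p..<b}}"
      have fin: "finite ?A" "finite ?B" using finK[OF jS] by auto
      have "card ?A \<le> card ?B + 1"
      proof (cases "p = a")
        case True
        then show ?thesis by simp
      next
        case False
        then obtain r where r: "p = Suc r" "a \<le> r" using p(1) by (cases p) auto
        \<comment> \<open>A destroyed bundle starts at \<open>r\<close> or earlier. It cannot end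
          before \<open>r\<close>, since the prefix up to there is worth less than the threshold and
          the bundle is not. By convexity it contains \<open>r\<close>, and disjointness leaves room
          for only one such bundle.\<close>
        have lost: "r \<in> F j k" if k: "k \<in> ?A - ?B" for k
        proof -
          have sub: "F j k \<subseteq> {a..<b}" and kK: "k \<in> K j" using k by auto
          obtain x where x: "x \<in> F j k" "x \<le> r" using k r by force
          have "\<not> F j k \<subseteq> {a..<r}"
          proof
            assume "F j k \<subseteq> {a..<r}"
            then have "sum (u j) (F j k) \<le> sum (u j) {a..<r}"
              using nonneg[OF jST] by (intro sum_mono2) auto
            then show False using before[OF jST, of r] r val[OF jS kK] by simp
          qed
          then obtain y where y: "y \<in> F j k" "r \<le> y" using sub by force
          show ?thesis using conv[OF jS kK x(1) y(1) x(2) y(2)] .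
        qed
        have "card (?A - ?B) \<le> 1"
        proof (rule ccontr)
          assume "\<not> card (?A - ?B) \<le> 1"
          then obtain k l where "k \<in> ?A - ?B" "l \<in> ?A - ?B" "k \<noteq> l"
            by (metis (no_types, lifting) card_le_Suc0_iff_eq fin(1) finite_Diff One_nat_def)
          then show False using lost disj[OF jS, of k l] by blast
        qed
        moreover have "card ?A \<le> card (?A - ?B) + card ?B"
          using card_mono[of "(?A - ?B) \<union> ?B" ?A] card_Un_le[of "?A - ?B" ?B] fin by force
        ultimately show ?thesis by simp
      qed
      then show ?thesis using S[OF jS] cards(1) by linarith
    qed
    have "\<exists>I. (\<forall>j\<in>S' \<union> T'. (\<exists>l h. I j = {l..<h}) \<and> thr j \<le> sum (u j) (I j)) \<and>
      (\<forall>j\<in>S' \<union> T'. \<forall>k\<in>S' \<union> T'. j \<noteq> k \<longrightarrow> I j \<inter> I k = {}) \<and> (\<Union>j\<in>S' \<union> T'. I j) = {p..<b}"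
    proof (rule less.hyps)
      show "card S' + card T' < card S + card T" using cards(1) by simp
      show "S' \<inter> T' = {}" "finite S'" "finite T'" using ST fS fT unfolding S'_def T'_def by auto
    next
      fix j k x y z assume "j \<in> S'" "k \<in> K j" "x \<in> F j k" "y \<in> F j k" "x \<le> z" "z \<le> y"
      then show "z \<in> F j k" using conv[of j k x y z] unfolding S'_def by blast
    next
      fix j k l assume "j \<in> S'" "k \<in> K j" "l \<in> K j" "k \<noteq> l"
      then show "F j k \<inter> F j l = {}" using disj[of j k l] unfolding S'_def by blast
    qed (use ne' pb T' S' nonneg thr small finK val in \<open>auto simp: S'_def T'_def\<close>)
    then obtain I where I: "\<forall>j\<in>S' \<union> T'. (\<exists>l h. I j = {l..<h}) \<and> thr j \<le> sum (u j) (I j)"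
      "\<forall>j\<in>S' \<union> T'. \<forall>k\<in>S' \<union> T'. j \<noteq> k \<longrightarrow> I j \<inter> I k = {}" "(\<Union>j\<in>S' \<union> T'. I j) = {p..<b}"
      by blast
    have eq: "S \<union> T = insert i (S' \<union> T')" "i \<notin> S' \<union> T'" using i unfolding S'_def T'_def by auto
    have away: "{a..<p} \<inter> I j = {}" if "j \<in> S' \<union> T'" for j
    proof -
      have "I j \<subseteq> {p..<b}" using I(3) that by blast
      then show ?thesis by force
    qed
    define I' where "I' = I(i := {a..<p})"
    have other: "I' j = I j" if "j \<in> S' \<union> T'" for j
      using that eq(2) unfolding I'_def by auto
    have self: "I' i = {a..<p}" unfolding I'_def by simp
    show ?thesis
    proof (intro exI[of _ I'] conjI ballI impI)
      fix j assume "j \<in> S \<union> T"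
      then show "\<exists>l h. I' j = {l..<h}" "thr j \<le> sum (u j) (I' j)"
        using I(1) i(2) other self unfolding eq(1) by (metis insertE)+
    next
      fix j k assume "j \<in> S \<union> T" "k \<in> S \<union> T" "j \<noteq> k"
      then show "I' j \<inter> I' k = {}"
        using I(2) away other self unfolding eq(1) by (metis Int_commute insertE)
    next
      have "(\<Union>j\<in>S \<union> T. I' j) = {a..<p} \<union> (\<Union>j\<in>S' \<union> T'. I j)"
        unfolding eq(1) using other self by simp
      also have "\<dots> = {a..<b}" using I(3) p(1) pb by (auto simp: ivl_disj_un)
      finally show "(\<Union>j\<in>S \<union> T. I' j) = {a..<b}" .
    qed
  qed
qed

section \<open>Connected sets of goods and windows of m consecutive positions\<close>

lemma arc_is_bundle:
  assumes "0 < m"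
  shows "is_bundle m ((\<lambda>q. q mod m) ` {a..<b})"
proof -
  let ?S = "(\<lambda>q. q mod m) ` {a..<b}"
  let ?R = "{(x, y). x \<in> ?S \<and> y \<in> ?S \<and> cyc_adj m x y}"
  have sym: "sym (?R\<^sup>*)"
    by (intro sym_rtrancl symI) (auto simp: cyc_adj_def)
  have up: "(p mod m, (p + k) mod m) \<in> ?R\<^sup>*" if "a \<le> p" "p + k < b" for p k
    using that
  proof (induction k)
    case (Suc k)
    have "((p + k) mod m, (p + Suc k) mod m) \<in> ?R"
      using Suc.prems assms by (auto simp: cyc_adj_def mod_Suc_eq)
    then show ?case using Suc by (meson Suc_lessD add_Suc_right rtrancl.rtrancl_into_rtrancl less_trans lessI add_less_cancel_left)
  qed simp
  have "(p mod m, q mod m) \<in> ?R\<^sup>*" if "p \<in> {a..<b}" "q \<in> {a..<b}" for p q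
  proof (cases "p \<le> q")
    case True
    then show ?thesis using up[of p "q - p"] that by simp
  next
    case False
    then have "(q mod m, p mod m) \<in> ?R\<^sup>*" using up[of q "p - q"] that by simp
    then show ?thesis using sym by (simp add: sym_def)
  qed
  then show ?thesis unfolding is_bundle_def using assms by auto
qed

text \<open>Connectedness in the form used below: two gaps \<open>b\<close> and \<open>d\<close>
  separate \<open>c\<close> from \<open>a\<close> on both sides of the cycle, so no walk inside
  \<open>S\<close> joins them.\<close>

lemma bundle_no_crossing:
  assumes S: "is_bundle m S" and "a < b" "b < c" "c < d" "d \<le> a + m"
    and aS: "a mod m \<in> S" and bS: "b mod m \<notin> S" and cS: "c mod m \<in> S" and dS: "d mod m \<notin> S"
  shows False
proof -
  let ?R = "{(x, y). x \<in> S \<and> y \<in> S \<and> cyc_adj m x y}"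
  \<comment> \<open>Invariant of a walk inside \<open>S\<close> from \<open>c\<close>: its current
    good has a position strictly between the two gaps, since a single step could leave this range
    only onto a gap.\<close>
  have "\<exists>p. b < p \<and> p < d \<and> p mod m = y" if "(c mod m, y) \<in> ?R\<^sup>*" for y
    using that
  proof (induction rule: rtrancl_induct)
    case base
    then show ?case using assms by blast
  next
    case (step y z)
    then obtain p where p: "b < p" "p < d" "p mod m = y" by blast
    have yz: "y \<in> S" "z \<in> S" "z < m" "z = Suc y mod m \<or> y = Suc z mod m"
      using step.hyps by (auto simp: cyc_adj_def)
    from yz(4) show ?case
    proof
      assume "z = Suc y mod m"
      then have z: "Suc p mod m = z" using p(3) by (metis mod_Suc_eq)
      then have "Suc p \<noteq> d" using yz dS by blast
      then show ?thesis using p z by (intro exI[of _ "Suc p"]) simp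
    next
      assume y: "y = Suc z mod m"
      obtain r where r: "p = Suc r" using p by (cases p) auto
      have "Suc r mod m = Suc z mod m" using y p r by simp
      then have "r mod m = z mod m" by (simp add: mod_Suc split: if_splits)
      then have z: "r mod m = z" using yz by simp
      then have "r \<noteq> b" using yz bS by blast
      then show ?thesis using p r z by (intro exI[of _ r]) simp
    qed
  qed
  moreover have "(c mod m, a mod m) \<in> ?R\<^sup>*" using S aS cS unfolding is_bundle_def by blast
  ultimately obtain p where p: "b < p" "p < d" "p mod m = a mod m" by blast
  \<comment> \<open>Impossible, since \<open>a < p < a + m\<close>.\<close>
  then have "m dvd p - a" using assms by (metis less_imp_le less_trans mod_eq_dvd_iff_nat)
  then show False using p assms by (auto dest!: dvd_imp_le)
qed

lemma bij_betw_mod_window: "bij_betw (\<lambda>q. q mod m) {a..<a + m} {..<m :: nat}"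
proof -
  have "inj_on (\<lambda>q. q mod m) {a..<a + m}"
  proof (rule inj_onI)
    have le: "x = y" if "x mod m = y mod m" "a \<le> x" "x \<le> y" "y < a + m" for x y
    proof (rule ccontr)
      assume "x \<noteq> y"
      have "m dvd y - x" using that mod_eq_dvd_iff_nat by metis
      then show False using that \<open>x \<noteq> y\<close> by (auto dest!: dvd_imp_le)
    qed
    fix x y assume "x \<in> {a..<a + m}" "y \<in> {a..<a + m}" "x mod m = y mod m"
    then show "x = y" using le[of x y] le[of y x] by (cases "x \<le> y") auto
  qed
  moreover from this have "(\<lambda>q. q mod m) ` {a..<a + m} = {..<m}"
    by (intro card_subset_eq) (auto simp: card_image)
  ultimately show ?thesis unfolding bij_betw_def by simp
qed

text \<open>Each good has exactly one position in a window of \<open>m\<close> positions, so a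
  bundle may be evaluated in any window.\<close>

lemma sum_mod_window:
  fixes f :: "nat \<Rightarrow> real"
  assumes "S \<subseteq> {..<m}"
  shows "sum (\<lambda>q. f (q mod m)) {q \<in> {a..<a + m}. q mod m \<in> S} = sum f S"
proof -
  have bij: "inj_on (\<lambda>q. q mod m) {a..<a + m}" "(\<lambda>q. q mod m) ` {a..<a + m} = {..<m}"
    using bij_betw_mod_window[of m a] unfolding bij_betw_def by blast+
  let ?W = "{q \<in> {a..<a + m}. q mod m \<in> S}"
  have "S \<subseteq> (\<lambda>q. q mod m) ` ?W"
  proof
    fix s assume s: "s \<in> S"
    then have "s \<in> (\<lambda>q. q mod m) ` {a..<a + m}" using assms bij(2) by blast
    then obtain q where "q \<in> {a..<a + m}" "s = q mod m" by (rule imageE)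
    then show "s \<in> (\<lambda>q. q mod m) ` ?W" using s by (intro image_eqI[of _ _ q]) simp_all
  qed
  moreover have "(\<lambda>q. q mod m) ` ?W \<subseteq> S" by blast
  moreover have "inj_on (\<lambda>q. q mod m) ?W" using bij(1) by (rule inj_on_subset) blast
  ultimately have "bij_betw (\<lambda>q. q mod m) ?W S" unfolding bij_betw_def by blast
  then show ?thesis by (rule sum.reindex_bij_betw)
qed

lemma sum_full_window:
  fixes f :: "nat \<Rightarrow> real"
  assumes "0 < m"
  shows "(\<Sum>q=a..<a + m. f (q mod m)) = sum f {..<m}"
proof -
  have "{q \<in> {a..<a + m}. q mod m \<in> {..<m}} = {a..<a + m}" using assms by auto
  then show ?thesis using sum_mod_window[of "{..<m}" m f a] by simp
qed

section \<open>Existence of maximin splits\<close>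

text \<open>Every minimum is the utility of some set of goods, so the supremum ranges over finitely
  many values. The split with all goods in one part shows that there is at least one.\<close>

lemma mms_attained:
  assumes "1 \<le> n" "0 < m"
  shows "\<exists>P. is_split m n P \<and> (\<forall>k\<in>{1..n}. mms m n u \<le> util u (P k))"
proof -
  let ?V = "{Min ((\<lambda>i. util u (P i)) ` {1..n}) | P. is_split m n P}"
  have "?V \<subseteq> util u ` Pow {..<m}"
  proof
    fix v assume "v \<in> ?V"
    then obtain P where P: "is_split m n P" "v = Min ((\<lambda>i. util u (P i)) ` {1..n})" by blast
    then have "v \<in> (\<lambda>i. util u (P i)) ` {1..n}" using assms by (auto intro!: Min_in)
    then obtain i where i: "i \<in> {1..n}" "v = util u (P i)" by blast
    then have "P i \<subseteq> {..<m}" using P(1) unfolding is_split_def by blast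
    then show "v \<in> util u ` Pow {..<m}" using i(2) by blast
  qed
  then have fin: "finite ?V" by (rule finite_subset) simp
  have "is_bundle m {..<m}"
    using arc_is_bundle[of m 0 m] bij_betw_mod_window[of m 0] assms unfolding bij_betw_def by simp
  then have "is_split m n (\<lambda>i. if i = 1 then {..<m} else {})"
    using assms unfolding is_split_def by (auto simp: is_bundle_def)
  then have ne: "?V \<noteq> {}" by blast
  have "Sup ?V \<in> ?V" unfolding cSup_eq_Max[OF fin ne] by (rule Max_in[OF fin ne])
  then obtain P where "is_split m n P" "mms m n u = Min ((\<lambda>i. util u (P i)) ` {1..n})"
    unfolding mms_def by blast
  then show ?thesis by (intro exI[of _ P]) auto
qed


section \<open>Cuts of a split\<close>

text \<open>From here on the cycle is unrolled: position q stands for the good q mod m, and the cut q lies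
  between the positions q and q + 1.\<close>

definition is_cut :: "nat \<Rightarrow> nat \<Rightarrow> (nat \<Rightarrow> nat set) \<Rightarrow> nat \<Rightarrow> bool" where
  "is_cut m n P q \<longleftrightarrow> \<not> (\<exists>k\<in>{1..n}. q mod m \<in> P k \<and> Suc q mod m \<in> P k)"

lemma is_cut_mod [simp]: "is_cut m n P (q mod m) \<longleftrightarrow> is_cut m n P q"
  by (simp add: is_cut_def mod_Suc_eq)

lemma split_part:
  assumes "is_split m n P" "0 < m"
  obtains k where "k \<in> {1..n}" "q mod m \<in> P k"
proof -
  have "q mod m \<in> (\<Union>i\<in>{1..n}. P i)" using assms unfolding is_split_def by simp
  then show ?thesis using that by blast
qed

lemma split_part_unique:
  assumes "is_split m n P" "k \<in> {1..n}" "l \<in> {1..n}" "x \<in> P k" "x \<in> P l"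
  shows "k = l"
  using assms unfolding is_split_def by blast

text \<open>Charge a cut to the part that ends there. A part charged twice would be left at two
  places of the cycle and so would be disconnected.\<close>

lemma card_cuts_le:
  assumes P: "is_split m n P" and m: "0 < m"
  shows "card {q \<in> {..<m}. is_cut m n P q} \<le> n"
proof -
  let ?C = "{q \<in> {..<m}. is_cut m n P q}"
  have "\<forall>q. \<exists>k\<in>{1..n}. q mod m \<in> P k" using split_part[OF P m] by metis
  then obtain col where col: "\<And>q. col q \<in> {1..n}" "\<And>q. q mod m \<in> P (col q)" by metis
  have ne: "Suc q mod m \<notin> P (col q)" if "is_cut m n P q" for q
    using that col unfolding is_cut_def by blast
  have "inj_on col ?C"
  proof (rule linorder_inj_onI')
    fix q r assume q: "q \<in> ?C" and r: "r \<in> ?C" and less: "q < r"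
    show "col q \<noteq> col r"
    proof
      assume eq: "col q = col r"
      \<comment> \<open>The good after a cut is outside the charged part, so neither cut directly
        follows the other around the cycle. This gives the strict inequalities that
        \<open>bundle_no_crossing\<close> needs.\<close>
      have "Suc q \<noteq> r" using ne[of q] q col(2)[of r] eq by auto
      moreover have "Suc r \<noteq> q + m"
      proof
        assume "Suc r = q + m"
        then have "Suc r mod m = q mod m" by simp
        then show False using ne[of r] r col(2)[of q] eq by auto
      qed
      ultimately have "Suc q < r" "Suc r < q + m" using less q r by auto
      moreover have "is_bundle m (P (col q))" using P col(1) unfolding is_split_def by blast
      moreover have "Suc q mod m \<notin> P (col q)" "Suc r mod m \<notin> P (col q)"
        using ne[of q] ne[of r] q r eq by simp_all
      ultimately show False
        using bundle_no_crossing[of m "P (col q)" q "Suc q" r "Suc r"] col(2)[of q] col(2)[of r] eq by simp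
    qed
  qed
  moreover have "col ` ?C \<subseteq> {1..n}" using col by blast
  ultimately show ?thesis using card_inj_on_le[of col ?C "{1..n}"] by simp
qed

text \<open>Without a cut, the part of good 0 spreads over the whole cycle and leaves nothing for a
  second part.\<close>

lemma ex_cut:
  assumes P: "is_split m n P" and n: "2 \<le> n" and ne: "\<And>k. k \<in> {1..n} \<Longrightarrow> P k \<noteq> {}"
    and m: "0 < m"
  shows "\<exists>q<m. is_cut m n P q"
proof (rule ccontr)
  assume "\<not> ?thesis"
  then have nc: "\<not> is_cut m n P q" if "q < m" for q using that by blast
  obtain k where k: "k \<in> {1..n}" "0 mod m \<in> P k" using split_part[OF P m] .
  have all: "q mod m \<in> P k" if "q < m" for q
    using that
  proof (induction q)
    case (Suc q)
    then obtain l where l: "l \<in> {1..n}" "q mod m \<in> P l" "Suc q mod m \<in> P l"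
      using nc[of q] unfolding is_cut_def by auto
    then have "l = k" using Suc split_part_unique[OF P] k by fastforce
    then show ?case using l by simp
  qed (use k in simp)
  define l :: nat where "l = (if k = 1 then 2 else 1)"
  have l: "l \<in> {1..n}" "l \<noteq> k" using n unfolding l_def by auto
  obtain x where x: "x \<in> P l" using ne[OF l(1)] by blast
  then have "x < m" using P l unfolding is_split_def by blast
  then show False using all[of x] x split_part_unique[OF P l(1) k(1), of x] l by simp
qed

text \<open>Cut \<open>q\<close> lies inside the arc exactly if \<open>q\<close> and
  \<open>Suc q\<close> both do. Without such cuts the arc lies in a single part \<open>k0\<close>,
  and all other parts survive in the remaining path.\<close>

lemma bundles_outside_arc:
  assumes P: "is_split m n P" and m: "0 < m" and ab: "a < b" "b \<le> a + m"
    and nc: "\<And>q. a \<le> q \<Longrightarrow> Suc q < b \<Longrightarrow> \<not> is_cut m n P q"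
  obtains k0 where "k0 \<in> {1..n}"
    and "\<And>k. k \<in> {1..n} - {k0} \<Longrightarrow> {q \<in> {a..<a + m}. q mod m \<in> P k} \<subseteq> {b..<a + m}"
    and "\<And>k x y z. \<lbrakk>k \<in> {1..n} - {k0}; x \<in> {q \<in> {a..<a + m}. q mod m \<in> P k};
      y \<in> {q \<in> {a..<a + m}. q mod m \<in> P k}; x \<le> z; z \<le> y\<rbrakk>
      \<Longrightarrow> z \<in> {q \<in> {a..<a + m}. q mod m \<in> P k}"
proof -
  obtain k0 where k0: "k0 \<in> {1..n}" "a mod m \<in> P k0" using split_part[OF P m] .
  have same: "q mod m \<in> P k0" if "a \<le> q" "q < b" for q
    using that
  proof (induction q rule: dec_induct)
    case (step q)
    then obtain l where l: "l \<in> {1..n}" "q mod m \<in> P l" "Suc q mod m \<in> P l"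
      using nc[of q] unfolding is_cut_def by auto
    then have "l = k0" using step split_part_unique[OF P] k0 by fastforce
    then show ?case using l by simp
  qed (use k0 in simp)
  have out: "q mod m \<notin> P k" if "k \<in> {1..n} - {k0}" "a \<le> q" "q < b" for k q
    using same[OF that(2,3)] split_part_unique[OF P _ k0(1), of k "q mod m"] that(1) by blast
  show thesis
  proof
    fix k assume k: "k \<in> {1..n} - {k0}"
    show "{q \<in> {a..<a + m}. q mod m \<in> P k} \<subseteq> {b..<a + m}" using out[OF k] by force
    fix x y z assume x: "x \<in> {q \<in> {a..<a + m}. q mod m \<in> P k}"
      and y: "y \<in> {q \<in> {a..<a + m}. q mod m \<in> P k}" and z: "x \<le> z" "z \<le> y"
    have "z mod m \<in> P k"
    proof (rule ccontr)
      \<comment> \<open>Position \<open>a + m\<close> is the good \<open>a\<close> again, which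
        belongs to \<open>k0\<close>. It serves as the second gap besides \<open>z\<close>, so the
        part cannot connect \<open>x\<close> and \<open>y\<close> around the end of the
        window.\<close>
      assume no: "z mod m \<notin> P k"
      then have "x < z" "z < y" using x y z by (auto simp: order_less_le)
      moreover have "a mod m \<notin> P k" using out[OF k, of a] ab by simp
      moreover have "is_bundle m (P k)" using P k unfolding is_split_def by blast
      ultimately show False
        using bundle_no_crossing[of m "P k" x z y "a + m"] x y no by auto
    qed
    then show "z \<in> {q \<in> {a..<a + m}. q mod m \<in> P k}" using x y z by auto
  qed (rule k0(1))
qed

section \<open>From the path back to the cycle\<close>

text \<open>Agent \<open>i\<close> takes the arc, and \<open>path_allocation\<close> divides the
  rest. Agents outside \<open>T\<close> lose at most one part to the arc, so \<open>n - 1\<close>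
  parts remain for the \<open>n - 1\<close> agents on the path.\<close>

lemma allocation_around_arc:
  fixes U :: "nat \<Rightarrow> nat \<Rightarrow> real"
  assumes m: "0 < m" and n: "2 \<le> n"
    and nonneg: "\<And>j g. j \<in> {1..n} \<Longrightarrow> g < m \<Longrightarrow> 0 \<le> U j g"
    and thr: "\<And>j. j \<in> {1..n} \<Longrightarrow> 0 \<le> thr j"
    and P: "\<And>j. j \<in> {1..n} \<Longrightarrow> is_split m n (P j)"
    and val: "\<And>j k. j \<in> {1..n} \<Longrightarrow> k \<in> {1..n} \<Longrightarrow> thr j \<le> util (U j) (P j k)"
    and ab: "a < b" "b \<le> a + m"
    and i: "i \<in> {1..n}" "thr i \<le> (\<Sum>q=a..<b. U i (q mod m))"
    and T: "T \<subseteq> {1..n} - {i}"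
    and small: "\<And>j g. j \<in> T \<Longrightarrow> g < m \<Longrightarrow> U j g \<le> thr j"
    and large: "\<And>j. j \<in> T \<Longrightarrow> (real n + real (card T) - 2) * thr j \<le> (\<Sum>q=b..<a + m. U j (q mod m))"
    and nc: "\<And>j q. j \<in> {1..n} - {i} - T \<Longrightarrow> a \<le> q \<Longrightarrow> Suc q < b \<Longrightarrow> \<not> is_cut m n (P j) q"
  shows "\<exists>A. is_split m n A \<and> (\<forall>j\<in>{1..n}. thr j \<le> util (U j) (A j))"
proof -
  define S where "S = {1..n} - {i} - T"
  have ST: "S \<union> T = {1..n} - {i}" "S \<inter> T = {}" and fin: "finite S" "finite T"
    using T finite_subset[OF T] unfolding S_def by auto
  have card: "card S + card T = n - 1"
    using card_Un_disjoint[OF fin ST(2)] ST(1) i(1) by simp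
  define F where "F j k = {q \<in> {a..<a + m}. q mod m \<in> P j k}" for j k
  have "\<exists>k0. k0 \<in> {1..n} \<and> (\<forall>k\<in>{1..n} - {k0}. F j k \<subseteq> {b..<a + m} \<and>
      (\<forall>x y z. x \<in> F j k \<longrightarrow> y \<in> F j k \<longrightarrow> x \<le> z \<longrightarrow> z \<le> y \<longrightarrow> z \<in> F j k))" if j: "j \<in> S" for j
  proof -
    have j': "j \<in> {1..n}" "j \<in> {1..n} - {i} - T" using j unfolding S_def by auto
    show ?thesis
      by (rule bundles_outside_arc[OF P[OF j'(1)] m ab nc[OF j'(2)]], assumption+, unfold F_def) blast
  qed
  then have "\<exists>k0. \<forall>j\<in>S. k0 j \<in> {1..n} \<and> (\<forall>k\<in>{1..n} - {k0 j}. F j k \<subseteq> {b..<a + m} \<and>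
      (\<forall>x y z. x \<in> F j k \<longrightarrow> y \<in> F j k \<longrightarrow> x \<le> z \<longrightarrow> z \<le> y \<longrightarrow> z \<in> F j k))"
    by (intro bchoice ballI)
  then obtain k0 where *: "\<forall>j\<in>S. k0 j \<in> {1..n} \<and> (\<forall>k\<in>{1..n} - {k0 j}. F j k \<subseteq> {b..<a + m} \<and>
      (\<forall>x y z. x \<in> F j k \<longrightarrow> y \<in> F j k \<longrightarrow> x \<le> z \<longrightarrow> z \<le> y \<longrightarrow> z \<in> F j k))" ..
  have k0: "k0 j \<in> {1..n}" if "j \<in> S" for j by (rule bspec[OF * that, THEN conjunct1])
  have sub: "F j k \<subseteq> {b..<a + m}" if "j \<in> S" "k \<in> {1..n} - {k0 j}" for j k
    by (rule bspec[OF bspec[OF * that(1), THEN conjunct2] that(2), THEN conjunct1])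
  have conv: "z \<in> F j k"
    if "j \<in> S" "k \<in> {1..n} - {k0 j}" "x \<in> F j k" "y \<in> F j k" "x \<le> z" "z \<le> y" for j k x y z
    using bspec[OF bspec[OF * that(1), THEN conjunct2] that(2), THEN conjunct2] that(3-6) by blast
  have "\<exists>I. (\<forall>j\<in>S \<union> T. (\<exists>l h. I j = {l..<h}) \<and> thr j \<le> sum (\<lambda>q. U j (q mod m)) (I j)) \<and>
    (\<forall>j\<in>S \<union> T. \<forall>k\<in>S \<union> T. j \<noteq> k \<longrightarrow> I j \<inter> I k = {}) \<and> (\<Union>j\<in>S \<union> T. I j) = {b..<a + m}"
  proof (rule path_allocation[where K = "\<lambda>j. {1..n} - {k0 j}" and F = F])
    show "S \<union> T \<noteq> {}" using card n fin by auto
    fix j assume j: "j \<in> T"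
    \<comment> \<open>The multiple required on the path, rewritten with
      \<open>card S + card T = n - 1\<close>.\<close>
    have eq: "real (card S) + 2 * real (card T) - 1 = real n + real (card T) - 2"
      using card n by simp
    show "(real (card S) + 2 * real (card T) - 1) * thr j \<le> (\<Sum>q=b..<a + m. U j (q mod m))"
      unfolding eq using j by (rule large)
  next
    fix j k assume j: "j \<in> S" and k: "k \<in> {1..n} - {k0 j}"
    have "j \<in> {1..n}" using j ST by blast
    then have "P j k \<subseteq> {..<m}" "thr j \<le> util (U j) (P j k)"
      using P[of j] k val[of j k] unfolding is_split_def is_bundle_def by blast+
    then show "thr j \<le> (\<Sum>q\<in>F j k. U j (q mod m))"
      using sum_mod_window[of "P j k" m "U j" a] unfolding F_def util_def by simp
  next
    fix j assume j: "j \<in> S"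
    have "{k \<in> {1..n} - {k0 j}. F j k \<subseteq> {b..<a + m}} = {1..n} - {k0 j}" using sub[OF j] by blast
    then show "card S + card T \<le> card {k \<in> {1..n} - {k0 j}. F j k \<subseteq> {b..<a + m}}"
      using card k0[OF j] by simp
  next
    fix j k l assume j: "j \<in> S" and kl: "k \<in> {1..n} - {k0 j}" "l \<in> {1..n} - {k0 j}" "k \<noteq> l"
    have "j \<in> {1..n}" using j ST by blast
    then show "F j k \<inter> F j l = {}"
      using split_part_unique[OF P[of j], of k l] kl unfolding F_def by blast
  next
    fix j k x y z
    assume "j \<in> S" "k \<in> {1..n} - {k0 j}" "x \<in> F j k" "y \<in> F j k" "x \<le> z" "z \<le> y"
    then show "z \<in> F j k" by (rule conv)
  qed (use fin ST ab nonneg m thr small in auto)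
  then obtain I where I0:
      "(\<forall>j\<in>{1..n} - {i}. (\<exists>l h. I j = {l..<h}) \<and> thr j \<le> (\<Sum>q\<in>I j. U j (q mod m))) \<and>
      (\<forall>j\<in>{1..n} - {i}. \<forall>k\<in>{1..n} - {i}. j \<noteq> k \<longrightarrow> I j \<inter> I k = {}) \<and>
      (\<Union>j\<in>{1..n} - {i}. I j) = {b..<a + m}"
    unfolding ST(1) ..
  have I: "\<And>j. j \<in> {1..n} - {i} \<Longrightarrow> \<exists>l h. I j = {l..<h}"
      "\<And>j. j \<in> {1..n} - {i} \<Longrightarrow> thr j \<le> (\<Sum>q\<in>I j. U j (q mod m))"
      "\<And>j k. j \<in> {1..n} - {i} \<Longrightarrow> k \<in> {1..n} - {i} \<Longrightarrow> j \<noteq> k \<Longrightarrow> I j \<inter> I k = {}"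
      "(\<Union>j\<in>{1..n} - {i}. I j) = {b..<a + m}"
    using I0 by simp_all
  define J where "J j = (if j = i then {a..<b} else I j)" for j
  have Jint: "\<exists>l h. J j = {l..<h}" and Jval: "thr j \<le> (\<Sum>q\<in>J j. U j (q mod m))"
    if "j \<in> {1..n}" for j using I(1,2)[of j] i that unfolding J_def by auto
  have JUn: "(\<Union>j\<in>{1..n}. J j) = {a..<a + m}"
  proof -
    have "(\<Union>j\<in>{1..n}. J j) = {a..<b} \<union> (\<Union>j\<in>{1..n} - {i}. I j)"
      using i(1) unfolding J_def by auto
    then show ?thesis using I(4) ab by (auto simp: ivl_disj_un)
  qed
  have away: "{a..<b} \<inter> I j = {}" if "j \<in> {1..n} - {i}" for j
  proof -
    have "I j \<subseteq> {b..<a + m}" using I(4) that by blast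
    then show ?thesis by force
  qed
  have Jdisj: "J j \<inter> J k = {}" if "j \<in> {1..n}" "k \<in> {1..n}" "j \<noteq> k" for j k
    using I(3)[of j k] away[of j] away[of k] that unfolding J_def by (auto split: if_splits)
  \<comment> \<open>Folding the pieces back onto the cycle is injective on the window, so
    disjointness and values are kept.\<close>
  define A where "A j = (\<lambda>q. q mod m) ` J j" for j
  have inj: "inj_on (\<lambda>q. q mod m) {a..<a + m}" and img: "(\<lambda>q. q mod m) ` {a..<a + m} = {..<m}"
    using bij_betw_mod_window[of m a] unfolding bij_betw_def by auto
  have Jsub: "J j \<subseteq> {a..<a + m}" if "j \<in> {1..n}" for j using JUn that by blast
  have "is_split m n A"
    unfolding is_split_def
  proof (intro conjI ballI impI)
    fix j assume "j \<in> {1..n}"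
    then show "is_bundle m (A j)" using Jint[of j] arc_is_bundle[OF m] unfolding A_def by auto
  next
    fix j k assume jk: "j \<in> {1..n}" "k \<in> {1..n}" "j \<noteq> k"
    have "A j \<inter> A k = (\<lambda>q. q mod m) ` (J j \<inter> J k)"
      unfolding A_def by (rule inj_on_image_Int[OF inj Jsub Jsub, symmetric]) (use jk in auto)
    then show "A j \<inter> A k = {}" using Jdisj[OF jk] by simp
  next
    have "(\<Union>j\<in>{1..n}. A j) = (\<lambda>q. q mod m) ` (\<Union>j\<in>{1..n}. J j)" unfolding A_def by blast
    then show "(\<Union>j\<in>{1..n}. A j) = {..<m}" using JUn img by simp
  qed
  moreover have "thr j \<le> util (U j) (A j)" if j: "j \<in> {1..n}" for j
    using Jval[OF j] sum.reindex[OF inj_on_subset[OF inj Jsub[OF j]], of "U j"]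
    unfolding A_def util_def by (simp add: o_def)
  ultimately show ?thesis by blast
qed

section \<open>A valuable arc with few cuts inside\<close>

text \<open>Each of the \<open>r\<close> pieces of a period is counted by exactly \<open>x\<close>
  of the arcs of \<open>x\<close> consecutive pieces. In the induction, one more piece per arc adds
  a telescoping sum over a full period.\<close>

lemma sum_shifted_differences:
  fixes H :: "nat \<Rightarrow> real"
  assumes "\<And>k. H (k + r) = H k + t"
  shows "(\<Sum>k<r. H (k + x) - H k) = real x * t"
proof (induction x)
  case (Suc x)
  have "(\<Sum>k<r. H (Suc k + x) - H (k + x)) = t"
    using sum_lessThan_telescope[of "\<lambda>k. H (k + x)" r] assms[of x] by (simp add: add.commute)
  then have "(\<Sum>k<r. H (k + Suc x) - H k) = (\<Sum>k<r. H (k + x) - H k) + t"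
    by (simp add: sum_subtractf)
  then show ?case using Suc by (simp add: algebra_simps)
qed simp

text \<open>Averaging over the \<open>card X\<close> arcs that run from one cut to the
  \<open>x\<close>-th cut after it. Strictly inside such an arc lie only cuts with
  \<open>x - 1\<close> intermediate indices, and \<open>x \<le> card X\<close> keeps it within one
  turn.\<close>

lemma ex_valuable_arc_few_labels:
  fixes f :: "nat \<Rightarrow> real" and X :: "(nat \<times> 'a) set"
  assumes X: "finite X" "X \<noteq> {}" "X \<subseteq> {..<m} \<times> UNIV" and x: "0 < x" "x \<le> card X" and m: "0 < m"
  obtains a b where "a \<le> b" "b \<le> a + m"
    and "real x * sum f {..<m} \<le> real (card X) * (\<Sum>q=a..<b. f (q mod m))"
    and "card {j. \<exists>q. a \<le> q \<and> Suc q < b \<and> (q mod m, j) \<in> X} < x"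
    and "finite {j. \<exists>q. a \<le> q \<and> Suc q < b \<and> (q mod m, j) \<in> X}"
proof -
  obtain xs where xs: "set xs = X" "distinct xs" using finite_distinct_list[OF X(1)] by blast
  define ys where "ys = sort_key fst xs"
  define R where "R = card X"
  have R: "0 < R" unfolding R_def using X card_gt_0_iff by blast
  have ys: "set ys = X" "length ys = R" "sorted (map fst ys)"
    using xs distinct_card[OF xs(2)] unfolding ys_def R_def by auto
  \<comment> \<open>The k-th cut of the unrolled cycle, counted with multiplicity; H below telescopes because e
    is periodic.\<close>
  define e where "e k = fst (ys ! (k mod R)) + m * (k div R)" for k
  have fst_less: "fst (ys ! (k mod R)) < m" for k
  proof -
    have "ys ! (k mod R) \<in> X" using ys R nth_mem[of "k mod R" ys] by simp
    then show ?thesis using X(3) by auto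
  qed
  have "e k \<le> e (Suc k)" for k
  proof (cases "Suc (k mod R) = R")
    case True
    then have "Suc k mod R = 0" "Suc k div R = Suc (k div R)" by (simp_all add: mod_Suc div_Suc)
    then show ?thesis using fst_less[of k] unfolding e_def by simp
  next
    case False
    then have eq: "Suc k mod R = Suc (k mod R)" "Suc k div R = k div R" by (simp_all add: mod_Suc div_Suc)
    then have "Suc (k mod R) < R" using R mod_less_divisor[of R "Suc k"] by simp
    then have "fst (ys ! (k mod R)) \<le> fst (ys ! Suc (k mod R))"
      using sorted_nth_mono[OF ys(3), of "k mod R" "Suc (k mod R)"] ys(2) by simp
    then show ?thesis using eq unfolding e_def by simp
  qed
  then have mono: "e k \<le> e l" if "k \<le> l" for k l using that by (rule lift_Suc_mono_le)
  have per: "e (k + R) = e k + m" for k using R unfolding e_def by simp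
  define H where "H k = (\<Sum>q<Suc (e k). f (q mod m))" for k
  have win: "(\<Sum>q=z..<z + m. f (q mod m)) = sum f {..<m}" for z
    using m by (rule sum_full_window)
  have "H (k + R) = H k + sum f {..<m}" for k
  proof -
    have "H (k + R) = H k + (\<Sum>q=Suc (e k)..<Suc (e k) + m. f (q mod m))"
      unfolding H_def per lessThan_atLeast0 by (subst sum.atLeastLessThan_concat) auto
    then show ?thesis unfolding win .
  qed
  then have total: "(\<Sum>k<R. H (k + x) - H k) = real x * sum f {..<m}"
    by (rule sum_shifted_differences)
  have "\<exists>k<R. real x * sum f {..<m} \<le> real R * (H (k + x) - H k)"
  proof (rule ccontr)
    assume "\<not> ?thesis"
    then have "(\<Sum>k<R. real R * (H (k + x) - H k)) < (\<Sum>k<R. real x * sum f {..<m})"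
      using R by (intro sum_strict_mono) auto
    also have "\<dots> = real R * (real x * sum f {..<m})" by simp
    finally show False unfolding sum_distrib_left[symmetric] total by simp
  qed
  then obtain k where k: "real x * sum f {..<m} \<le> real R * (H (k + x) - H k)" by blast
  \<comment> \<open>Cut \<open>e k\<close> lies behind position \<open>e k\<close>, hence the
    successors.\<close>
  let ?a = "Suc (e k)" and ?b = "Suc (e (k + x))"
  have ab: "?a \<le> ?b" "?b \<le> ?a + m"
    using mono[of k "k + x"] mono[of "k + x" "k + R"] per[of k] x unfolding R_def by auto
  have H: "H (k + x) - H k = (\<Sum>q=?a..<?b. f (q mod m))"
    using sum.atLeastLessThan_concat[of 0 ?a ?b "\<lambda>q. f (q mod m)"] ab
    unfolding H_def lessThan_atLeast0 by simp
  define lab where "lab l = snd (ys ! (l mod R))" for l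
  let ?M = "{j. \<exists>q. ?a \<le> q \<and> Suc q < ?b \<and> (q mod m, j) \<in> X}"
  have sub: "?M \<subseteq> lab ` {k<..<k + x}"
  proof
    fix j assume "j \<in> ?M"
    then obtain q where q: "?a \<le> q" "Suc q < ?b" "(q mod m, j) \<in> X" by blast
    then obtain t where t: "t < R" "ys ! t = (q mod m, j)" using ys by (metis in_set_conv_nth)
    \<comment> \<open>The index of this labelled cut in the periodic list: \<open>t\<close> within a
      turn, plus \<open>R\<close> for every full turn before \<open>q\<close>. Monotonicity of
      \<open>e\<close> then puts it strictly between \<open>k\<close> and
      \<open>k + x\<close>.\<close>
    define l where "l = t + R * (q div m)"
    have l: "l mod R = t" "l div R = q div m" using t R unfolding l_def by auto
    have "e l = q" unfolding e_def l using t by simp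
    then have "k < l" "l < k + x"
      using q mono[of l k] mono[of "k + x" l] by (meson Suc_le_lessD not_le not_less Suc_less_eq)+
    moreover have "lab l = j" unfolding lab_def l using t by simp
    ultimately show "j \<in> lab ` {k<..<k + x}" by force
  qed
  have "card (lab ` {k<..<k + x}) \<le> x - 1" using card_image_le[of "{k<..<k + x}" lab] by simp
  moreover have "card ?M \<le> card (lab ` {k<..<k + x})" by (rule card_mono[OF _ sub]) simp
  ultimately have few: "card ?M < x" using x(1) by linarith
  have fin: "finite ?M" by (rule finite_subset[OF sub]) simp
  show thesis by (rule that[OF ab k[unfolded R_def H] few fin])
qed

section \<open>The constant c\<close>

text \<open>The supremum is a maximum: the term \<open>n / d\<close> tends to 0, so from some point
  on no \<open>d\<close> beats the positive value at \<open>n\<close>.\<close>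

lemma c_const_attained:
  assumes n: "2 \<le> n"
  obtains d where "n \<le> d" and "c_const n = min (real n / real d)
      (real n / (real_of_int \<lceil>real n ^ 2 / real d\<rceil> + real n - 2))"
proof -
  define f where "f d = min (real n / real d)
      (real n / (real_of_int \<lceil>real n ^ 2 / real d\<rceil> + real n - 2))" for d
  have pos: "0 < f d" if "n \<le> d" for d
  proof -
    have "0 < real n ^ 2 / real d" using that n by simp
    then have "1 \<le> \<lceil>real n ^ 2 / real d\<rceil>" by (simp add: one_le_ceiling)
    then have "1 \<le> real_of_int \<lceil>real n ^ 2 / real d\<rceil>" by (metis of_int_1_le_iff)
    then have "0 < real_of_int \<lceil>real n ^ 2 / real d\<rceil> + real n - 2" using n by linarith
    then show ?thesis using that n unfolding f_def by simp
  qed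
  \<comment> \<open>Beyond this bound \<open>n / d\<close> alone is at most
    \<open>f n\<close>.\<close>
  define D where "D = max n (nat \<lceil>real n / f n\<rceil>)"
  obtain d where d: "d \<in> {n..D}" "f d = Max (f ` {n..D})"
    using Max_in[of "f ` {n..D}"] unfolding D_def by fastforce
  have "f k \<le> f d" if "n \<le> k" for k
  proof (cases "k \<le> D")
    case True
    then show ?thesis using d that by simp
  next
    case False
    have "f n \<le> f d" using d unfolding D_def by simp
    have "real n / f n \<le> real k" using False unfolding D_def by linarith
    then have "real n / real k \<le> f n" using pos[of n] n that by (simp add: field_simps)
    then show ?thesis using \<open>f n \<le> f d\<close> unfolding f_def by linarith
  qed
  then have "(SUP k\<in>{n..}. f k) = f d"
    using d(1) by (intro cSup_eq_maximum) auto
  then show thesis using that d unfolding c_const_def f_def by auto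
qed

section \<open>Choosing the arc and counting what is left\<close>

theorem theorem4p4:
  fixes m n :: nat and U :: "nat \<Rightarrow> nat \<Rightarrow> real"
  assumes "m \<ge> 3" and "n \<ge> 2"
    and "\<And>i g. i \<in> {1..n} \<Longrightarrow> g < m \<Longrightarrow> U i g \<ge> 0"
  shows "\<exists>P. c_sufficient m n U (c_const n) P"
proof -
  have m: "0 < m" and n: "2 \<le> n" using assms by auto
  note nonneg = assms(3)
  obtain d where d: "n \<le> d" and cn: "c_const n = min (real n / real d)
      (real n / (real_of_int \<lceil>real n ^ 2 / real d\<rceil> + real n - 2))"
    using c_const_attained[OF n] .
  define c where "c = c_const n"
  define x where "x = nat \<lceil>real n ^ 2 / real d\<rceil>"
  have "0 < real n ^ 2 / real d" using d n by simp
  then have "0 < \<lceil>real n ^ 2 / real d\<rceil>" by (simp only: zero_less_ceiling)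
  then have x: "0 < x" "real_of_int \<lceil>real n ^ 2 / real d\<rceil> = real x" unfolding x_def by simp_all
  have xd: "real n ^ 2 / real d \<le> real x" unfolding x(2)[symmetric] by (rule le_of_int_ceiling)
  have c_eq: "c = min (real n / real d) (real n / (real x + real n - 2))"
    unfolding c_def cn x(2) ..
  have den: "0 < real x + real n - 2" using x(1) n by linarith
  \<comment> \<open>\<open>c \<le> 1\<close> makes every part of an agent's own maximin split
    acceptable, \<open>c * d \<le> n\<close> makes an average arc acceptable, and the last bound
    leaves enough value on the path.\<close>
  have c: "0 < c" "c \<le> 1" "c * real d \<le> real n" "c * (real x + real n - 2) \<le> real n"
  proof -
    have le: "c \<le> real n / real d" "c \<le> real n / (real x + real n - 2)" unfolding c_eq by simp_all
    show "0 < c" unfolding c_eq using d n den by simp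
    have "real n / real d \<le> 1" using d n by simp
    then show "c \<le> 1" using le by linarith
    show "c * real d \<le> real n" "c * (real x + real n - 2) \<le> real n"
      using le d n den by (simp_all add: pos_le_divide_eq)
  qed
  define w where "w j = mms m n (U j)" for j
  have "\<forall>j. \<exists>P. is_split m n P \<and> (\<forall>k\<in>{1..n}. w j \<le> util (U j) (P k))"
    using mms_attained[of n m] n m unfolding w_def by simp
  then obtain P where P: "\<And>j. is_split m n (P j)" "\<And>j k. k \<in> {1..n} \<Longrightarrow> w j \<le> util (U j) (P j k)"
    by metis
  have cover: "(\<Sum>k=1..n. util (U j) (P j k)) = sum (U j) {..<m}" for j
  proof -
    have "finite (P j k)" if "k \<in> {1..n}" for k
      using P(1)[of j] that unfolding is_split_def is_bundle_def by (meson finite_lessThan finite_subset)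
    then have "sum (U j) (\<Union>k\<in>{1..n}. P j k) = (\<Sum>k=1..n. sum (U j) (P j k))"
      using P(1)[of j] unfolding is_split_def by (intro sum.UNION_disjoint) auto
    then show ?thesis using P(1)[of j] unfolding is_split_def util_def by simp
  qed
  have total: "real n * w j \<le> sum (U j) {..<m}" for j
  proof -
    have "(\<Sum>k=1..n. w j) \<le> (\<Sum>k=1..n. util (U j) (P j k))" using P(2) by (intro sum_mono) simp
    then show ?thesis using cover by simp
  qed
  have part_nonneg: "0 \<le> util (U j) (P j k)" if "j \<in> {1..n}" "k \<in> {1..n}" for j k
  proof -
    have "P j k \<subseteq> {..<m}" using P(1)[of j] that(2) unfolding is_split_def is_bundle_def by blast
    then show ?thesis unfolding util_def using nonneg[OF that(1)] by (intro sum_nonneg) auto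
  qed
  \<comment> \<open>The maximum only spares a proof that maximin shares are non-negative.\<close>
  define thr where "thr j = c * max 0 (w j)" for j
  have thr: "0 \<le> thr j" "c * w j \<le> thr j" for j using c(1) unfolding thr_def by (simp_all add: mult_left_mono)
  have val: "thr j \<le> util (U j) (P j k)" if "j \<in> {1..n}" "k \<in> {1..n}" for j k
  proof -
    have "thr j \<le> 1 * max 0 (w j)" unfolding thr_def using c(2) by (intro mult_right_mono) auto
    then show ?thesis using P(2)[of k j] part_nonneg[OF that] that by simp
  qed
  have "\<exists>A. is_split m n A \<and> (\<forall>j\<in>{1..n}. thr j \<le> util (U j) (A j))"
  proof (cases "\<exists>i\<in>{1..n}. \<exists>g<m. thr i \<le> U i g")
    case True
    then obtain i g where i: "i \<in> {1..n}" and g: "g < m" "thr i \<le> U i g" by blast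
    \<comment> \<open>An arc of one good has no cut inside, so \<open>T\<close> may be
      empty.\<close>
    show ?thesis
      by (rule allocation_around_arc[where a = g and b = "Suc g" and i = i and T = "{}" and P = P])
        (use m n nonneg thr P val i g in auto)
  next
    case False
    then have small: "U j g < thr j" if "j \<in> {1..n}" "g < m" for j g using that by force
    \<comment> \<open>Otherwise the threshold is 0 and the single good 0 is acceptable.\<close>
    have wpos: "0 < w j" if "j \<in> {1..n}" for j
    proof (rule ccontr)
      assume "\<not> 0 < w j"
      then have "thr j = 0" unfolding thr_def by simp
      then show False using small[OF that m] nonneg[OF that m] by simp
    qed
    have thr_eq: "thr j = c * w j" if "j \<in> {1..n}" for j
      using wpos[OF that] unfolding thr_def by simp
    have thr_pos: "0 < thr j" if "j \<in> {1..n}" for j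
      using wpos[OF that] c(1) thr_eq[OF that] by simp
    have one: "1 \<in> {1..n}" using n by simp
    \<comment> \<open>Cuts are labelled by agents, so a cut shared by several agents counts once for
      each; this gives at most \<open>n ^ 2\<close> labelled cuts.\<close>
    define X where "X = {(q, j). q < m \<and> j \<in> {1..n} \<and> is_cut m n (P j) q}"
    have X_eq: "X = (\<Union>j\<in>{1..n}. {q \<in> {..<m}. is_cut m n (P j) q} \<times> {j})" unfolding X_def by auto
    have finX: "finite X" unfolding X_eq by auto
    have "card X \<le> (\<Sum>j=1..n. card ({q \<in> {..<m}. is_cut m n (P j) q} \<times> {j}))"
      unfolding X_eq by (rule card_UN_le) simp
    also have "\<dots> \<le> (\<Sum>j=1..n. n)"
      using card_cuts_le[OF P(1) m] by (intro sum_mono) (simp add: card_cartesian_product)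
    finally have cardX: "real (card X) \<le> real n ^ 2" by (simp add: power2_eq_square flip: of_nat_mult)
    have "P 1 k \<noteq> {}" if "k \<in> {1..n}" for k
      using P(2)[OF that, of 1] wpos[OF one] by (auto simp: util_def)
    then obtain q where "q < m" "is_cut m n (P 1) q" using ex_cut[OF P(1) n _ m] by blast
    then have "(q, 1) \<in> X" using one unfolding X_def by simp
    then have neX: "X \<noteq> {}" by blast
    have subX: "X \<subseteq> {..<m} \<times> UNIV" unfolding X_def by auto
    \<comment> \<open>With fewer than \<open>x\<close> labelled cuts in total, the arc is one full
      turn.\<close>
    define y where "y = min x (card X)"
    have cX: "0 < card X" using finX neX card_gt_0_iff by blast
    then have y: "0 < y" "y \<le> card X" "y \<le> x" using x(1) unfolding y_def by auto
    obtain a b where ab: "a \<le> b" "b \<le> a + m"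
      and arc: "real y * sum (U 1) {..<m} \<le> real (card X) * (\<Sum>q=a..<b. U 1 (q mod m))"
      and few: "card {j. \<exists>q. a \<le> q \<and> Suc q < b \<and> (q mod m, j) \<in> X} < y"
        "finite {j. \<exists>q. a \<le> q \<and> Suc q < b \<and> (q mod m, j) \<in> X}"
      using ex_valuable_arc_few_labels[OF finX neX subX y(1,2) m, of "U 1"] by blast
    have liked: "thr 1 \<le> (\<Sum>q=a..<b. U 1 (q mod m))"
    proof -
      \<comment> \<open>The average arc is worth at least \<open>y * n / card X\<close> maximin
        shares to agent 1; the claim is that this factor is at least \<open>c\<close>. It follows
        from \<open>card X \<le> n ^ 2 \<le> x * d\<close> and \<open>c * d \<le> n\<close>, or for
        a full turn from \<open>c \<le> 1\<close>.\<close>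
      have "real (card X) * c \<le> real y * real n"
      proof (cases "x \<le> card X")
        case True
        have "real (card X) * c \<le> real n ^ 2 * c" using cardX c(1) by (intro mult_right_mono) auto
        also have "\<dots> \<le> real x * real d * c"
          using xd d n c(1) by (intro mult_right_mono) (auto simp: pos_divide_le_eq)
        also have "\<dots> \<le> real x * real n" using mult_left_mono[OF c(3), of "real x"] by (simp add: mult_ac)
        finally show ?thesis using True unfolding y_def by simp
      next
        case False
        then show ?thesis using c n unfolding y_def by (intro mult_mono) auto
      qed
      then have "real (card X) * c * w 1 \<le> real y * real n * w 1"
        using wpos[OF one] by (intro mult_right_mono) auto
      also have "\<dots> \<le> real y * sum (U 1) {..<m}" using mult_left_mono[OF total[of 1], of "real y"] by (simp add: mult_ac)
      also note arc
      finally show ?thesis using cX thr_eq[OF one] by simp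
    qed
    \<comment> \<open>Shortest prefix acceptable to any agent, not only to agent 1: thus without its
      last good everybody values it below the threshold.\<close>
    define \<beta> where "\<beta> = (LEAST z. \<exists>i\<in>{1..n}. thr i \<le> (\<Sum>q=a..<z. U i (q mod m)))"
    have ex: "\<exists>i\<in>{1..n}. thr i \<le> (\<Sum>q=a..<b. U i (q mod m))" using liked one by blast
    have like: "\<exists>i\<in>{1..n}. thr i \<le> (\<Sum>q=a..<\<beta>. U i (q mod m))"
      unfolding \<beta>_def using ex by (rule LeastI)
    have \<beta>b: "\<beta> \<le> b" unfolding \<beta>_def using ex by (rule Least_le)
    have before: "(\<Sum>q=a..<z. U j (q mod m)) < thr j" if "j \<in> {1..n}" "z < \<beta>" for j z
      using not_less_Least[of z "\<lambda>z. \<exists>i\<in>{1..n}. thr i \<le> (\<Sum>q=a..<z. U i (q mod m))"] that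
      unfolding \<beta>_def by force
    have a\<beta>: "a < \<beta>" using like thr_pos by (rule_tac ccontr) force
    then obtain r where r: "\<beta> = Suc r" "a \<le> r" by (cases \<beta>) auto
    have twice: "(\<Sum>q=a..<\<beta>. U j (q mod m)) \<le> 2 * thr j" if "j \<in> {1..n}" for j
      using before[OF that, of r] small[OF that, of "r mod m"] m r by simp
    define M where "M = {j \<in> {1..n}. \<exists>q. a \<le> q \<and> Suc q < \<beta> \<and> is_cut m n (P j) q}"
    have finM: "finite M" unfolding M_def by simp
    have "M \<subseteq> {j. \<exists>q. a \<le> q \<and> Suc q < b \<and> (q mod m, j) \<in> X}"
      unfolding M_def X_def using \<beta>b m by (auto intro: less_le_trans)
    then have Mx: "card M < x" using card_mono[OF few(2)] few(1) y(3) by (meson less_le_trans le_less_trans)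
    have window: "(\<Sum>q=a..<a + m. U j (q mod m)) = sum (U j) {..<m}" for j
      using m by (rule sum_full_window)
    \<comment> \<open>The whole cycle is worth at least \<open>n\<close> maximin shares, hence at
      least \<open>x + n - 2\<close> thresholds.\<close>
    have rest: "(real x + real n - 2) * thr j - (\<Sum>q=a..<\<beta>. U j (q mod m)) \<le> (\<Sum>q=\<beta>..<a + m. U j (q mod m))"
      if "j \<in> {1..n}" for j
    proof -
      have "(real x + real n - 2) * thr j = c * (real x + real n - 2) * w j" using thr_eq[OF that] by simp
      also have "\<dots> \<le> real n * w j" using c(4) wpos[OF that] by (intro mult_right_mono) auto
      also have "\<dots> \<le> (\<Sum>q=a..<a + m. U j (q mod m))" using total[of j] window by simp
      also have "\<dots> = (\<Sum>q=a..<\<beta>. U j (q mod m)) + (\<Sum>q=\<beta>..<a + m. U j (q mod m))"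
        using a\<beta> \<beta>b ab by (simp add: sum.atLeastLessThan_concat)
      finally show ?thesis by simp
    qed
    obtain i where i: "i \<in> {1..n}" "thr i \<le> (\<Sum>q=a..<\<beta>. U i (q mod m))"
      and iM: "i \<notin> M \<Longrightarrow> \<forall>j\<in>M. (\<Sum>q=a..<\<beta>. U j (q mod m)) < thr j"
    proof (cases "\<exists>i\<in>M. thr i \<le> (\<Sum>q=a..<\<beta>. U i (q mod m))")
      case True
      then show ?thesis using that unfolding M_def by blast
    next
      case False
      then show ?thesis using that like by (metis not_le)
    qed
    show ?thesis
    proof (rule allocation_around_arc[where a = a and b = \<beta> and i = i and T = "M - {i}" and P = P])
      fix j assume j: "j \<in> M - {i}"
      then have jn: "j \<in> {1..n}" unfolding M_def by blast
      \<comment> \<open>If \<open>i\<close> is in \<open>M\<close>, then \<open>M - {i}\<close> has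
        at most \<open>x - 2\<close> members, which pays for the two thresholds that the arc may
        cost. Otherwise it has at most \<open>x - 1\<close>, and the arc costs each of them less
        than one threshold.\<close>
      have "(real n + real (card (M - {i})) - 2) * thr j
          \<le> (real x + real n - 2) * thr j - (\<Sum>q=a..<\<beta>. U j (q mod m))"
      proof (cases "i \<in> M")
        case True
        then have "card (M - {i}) + 2 \<le> x" using Mx card_Suc_Diff1[OF finM True] by simp
        then have "(real (card (M - {i})) + 2) * thr j \<le> real x * thr j"
          using thr(1) by (intro mult_right_mono) linarith+
        then show ?thesis using twice[OF jn] by (simp add: algebra_simps)
      next
        case False
        then have "card (M - {i}) + 1 \<le> x" using Mx by simp
        then have "(real (card (M - {i})) + 1) * thr j \<le> real x * thr j"
          using thr(1) by (intro mult_right_mono) linarith+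
        moreover have "(\<Sum>q=a..<\<beta>. U j (q mod m)) < thr j" using iM[OF False] j by blast
        ultimately show ?thesis by (simp add: algebra_simps)
      qed
      also note rest[OF jn]
      finally show "(real n + real (card (M - {i})) - 2) * thr j \<le> (\<Sum>q=\<beta>..<a + m. U j (q mod m))" .
    next
      fix j g assume "j \<in> M - {i}" "g < m"
      then show "U j g \<le> thr j" using small[of j g] unfolding M_def by auto
    qed (use m n nonneg thr P val i a\<beta> \<beta>b ab in \<open>auto simp: M_def\<close>)
  qed
  then obtain A where "is_split m n A" "\<forall>j\<in>{1..n}. thr j \<le> util (U j) (A j)" by blast
  then have "c_sufficient m n U (c_const n) A"
    unfolding c_sufficient_def using thr(2) unfolding c_def w_def by (meson order_trans)
  then show ?thesis by blast
qed

end
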